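(* Let $\underline{\mathcal{A}}=(\underline{a}_{ijkl})$ and $\overline{\mathcal{A}}=(\overline{a}_{ijkl})$ be symmetric real $4$th order $3$-dimensional tensors with $\underline{\mathcal{A}}\le\overline{\mathcal{A}}$, and let $\mathcal{A}^I=[\underline{\mathcal{A}},\overline{\mathcal{A}}]$. Suppose $\underline{a}_{1111}=\underline{a}_{2222}=\underline{a}_{3333}=0$. Then $\mathcal{A}^I$ is positive semi-definite if $\underline{a}_{iiij}=\overline{a}_{iiij}=0$ for all $i,j\in\{1,2,3\}$ with $i\ne j$, $\underline{a}_{1123}=-1$, $\overline{a}_{1123}=1$, $\underline{a}_{1223}=\underline{a}_{1233}=\overline{a}_{1223}=\overline{a}_{1233}=0$, $\underline{a}_{1122}\ge1$, $\underline{a}_{1133}\ge1$ and $\underline{a}_{2233}\ge0$.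
   Context: A tensor $\mathcal{A}=(a_{ijkl})$, $i,j,k,l\in\{1,2,3\}$, is symmetric if its entries are invariant under all permutations of the indices (so a condition on one entry applies to all entries with permuted indices). Inequalities between tensors are entrywise, and $[\underline{\mathcal{A}},\overline{\mathcal{A}}]$ is the set of all real $4$th order $3$-dimensional tensors $\mathcal{A}$ with $\underline{\mathcal{A}}\le\mathcal{A}\le\overline{\mathcal{A}}$ (interval tensor). A tensor $\mathcal{A}$ is positive semi-definite if $\mathcal{A}x^4=\sum_{i,j,k,l=1}^3a_{ijkl}x_ix_jx_kx_l\ge0$ for all $x\in\mathbb{R}^3\setminus\{0\}$. An interval tensor is positive semi-definite if every tensor in it is. *)

theory Defs
  imports "HOL-Analysis.Analysis" "HOL-Combinatorics.Permutations"
begin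

text \<open>
  A 4th order tensor is represented by its entries. The pointwise order on functions is then the
  entrywise order on tensors, so \<open>{L..U}\<close> is the interval tensor with bounds \<open>L\<close> and \<open>U\<close>;
  its members need not be symmetric. For dimension 3 the index type is \<open>3\<close>, whose elements are
  \<open>1, 2, 3\<close> (the numeral \<open>3\<close> coincides with \<open>0\<close>), as for vectors in \<open>real^3\<close>.
\<close>

type_synonym 'n tensor4 = "'n \<Rightarrow> 'n \<Rightarrow> 'n \<Rightarrow> 'n \<Rightarrow> real"

text \<open>
  The map \<open>idx\<close> assigns an index to each of the four positions \<open>0, 1, 2, 3\<close>;
  \<open>p\<close> permutes the positions.
\<close>

definition symmetric_tensor :: "'n tensor4 \<Rightarrow> bool" where
  "symmetric_tensor A \<longleftrightarrow>
     (\<forall>p idx. p permutes {0..<4::nat} \<longrightarrow>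
        A (idx (p 0)) (idx (p 1)) (idx (p 2)) (idx (p 3)) = A (idx 0) (idx 1) (idx 2) (idx 3))"

definition tensor_form :: "'n::finite tensor4 \<Rightarrow> real ^ 'n \<Rightarrow> real" where
  "tensor_form A x =
     (\<Sum>i\<in>UNIV. \<Sum>j\<in>UNIV. \<Sum>k\<in>UNIV. \<Sum>l\<in>UNIV. A i j k l * x $ i * x $ j * x $ k * x $ l)"

definition psd_tensor :: "'n::finite tensor4 \<Rightarrow> bool" where
  "psd_tensor A \<longleftrightarrow> (\<forall>x. x \<noteq> 0 \<longrightarrow> tensor_form A x \<ge> 0)"

definition psd_interval_tensor :: "'n::finite tensor4 set \<Rightarrow> bool" where
  "psd_interval_tensor AI \<longleftrightarrow> (\<forall>A\<in>AI. psd_tensor A)"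

end

theory Submission
  imports Defs
begin

text \<open>
  Write \<open>C\<close> for the midpoint \<open>(L + U) / 2\<close> and \<open>D\<close> for the radius \<open>(U - L) / 2\<close> of the interval
  tensor. Each monomial of the form of a member is smallest when its coefficient is at the endpoint
  of \<open>[L, U]\<close> opposite to the sign of the monomial, and this gives the bound
  \<open>tensor_form C x - tensor_form D \<bar>x\<bar>\<close> for all members at once (\<open>tensor_form_ge_midpoint_radius\<close>),
  even those that are not symmetric. Since \<open>C\<close> and \<open>D\<close> are symmetric, the bound is a combination of
  the 15 ternary quartic monomials (\<open>tensor_form_symmetric_3\<close>). A monomial that is a square
  contributes with its lower coefficient, those whose two bounds vanish contribute nothing, and
  \<open>x\<^sub>1\<^sup>2 x\<^sub>2 x\<^sub>3\<close> contributes \<open>- 12 x\<^sub>1\<^sup>2 \<bar>x\<^sub>2 x\<^sub>3\<bar>\<close>. What remains is at least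
  \<open>6 x\<^sub>1\<^sup>2 (x\<^sub>2\<^sup>2 + x\<^sub>3\<^sup>2 - 2 \<bar>x\<^sub>2 x\<^sub>3\<bar>) = 6 x\<^sub>1\<^sup>2 (\<bar>x\<^sub>2\<bar> - \<bar>x\<^sub>3\<bar>)\<^sup>2\<close>.
\<close>

text \<open>
  Used as permutative rewrite rules, the three adjacent transpositions bring the indices of every
  entry into a canonical order, like a bubble sort.
\<close>

lemma symmetric_tensor_transpositions:
  assumes "symmetric_tensor A"
  shows "A j i k l = A i j k l" "A i k j l = A i j k l" "A i j l k = A i j k l"
proof -
  define idx where "idx = (\<lambda>n::nat. if n = 0 then i else if n = 1 then j else if n = 2 then k else l)"
  have swap: "A (idx (p 0)) (idx (p 1)) (idx (p 2)) (idx (p 3)) = A (idx 0) (idx 1) (idx 2) (idx 3)"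
    if "p = Transposition.transpose a b" "a < 4" "b < 4" for p a b
    using assms permutes_swap_id[of a "{0..<4}" b] that
    unfolding symmetric_tensor_def by simp
  show "A j i k l = A i j k l" "A i k j l = A i j k l" "A i j l k = A i j k l"
    using swap[OF refl, of 0 1] swap[OF refl, of 1 2] swap[OF refl, of 2 3]
    by (simp_all add: idx_def Transposition.transpose_def)
qed

text \<open>
  The numerical factors are the multinomial coefficients: a monomial collects one term for each
  arrangement of its multiset of indices.
\<close>

lemma tensor_form_symmetric_3:
  fixes A :: "3 tensor4" and x :: "real ^ 3"
  assumes "symmetric_tensor A"
  shows "tensor_form A x =
      A 1 1 1 1 * (x $ 1) ^ 4 + A 2 2 2 2 * (x $ 2) ^ 4 + A 3 3 3 3 * (x $ 3) ^ 4
    + 4 * (A 1 1 1 2 * ((x $ 1) ^ 3 * x $ 2) + A 1 1 1 3 * ((x $ 1) ^ 3 * x $ 3)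
         + A 2 2 2 1 * ((x $ 2) ^ 3 * x $ 1) + A 2 2 2 3 * ((x $ 2) ^ 3 * x $ 3)
         + A 3 3 3 1 * ((x $ 3) ^ 3 * x $ 1) + A 3 3 3 2 * ((x $ 3) ^ 3 * x $ 2))
    + 6 * (A 1 1 2 2 * (x $ 1 * x $ 2)\<^sup>2 + A 1 1 3 3 * (x $ 1 * x $ 3)\<^sup>2
         + A 2 2 3 3 * (x $ 2 * x $ 3)\<^sup>2)
    + 12 * (A 1 1 2 3 * ((x $ 1)\<^sup>2 * (x $ 2 * x $ 3)) + A 1 2 2 3 * ((x $ 2)\<^sup>2 * (x $ 1 * x $ 3))
         + A 1 2 3 3 * ((x $ 3)\<^sup>2 * (x $ 1 * x $ 2)))"
  unfolding tensor_form_def sum_3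
  by (simp only: symmetric_tensor_transpositions[OF assms])
     (simp add: algebra_simps power2_eq_square power3_eq_cube power4_eq_xxxx)

text \<open>
  Every coefficient has the form \<open>c + t\<close> with \<open>\<bar>t\<bar> \<le> d\<close>, where \<open>c\<close> and \<open>d\<close> are the midpoint and the
  radius, so a monomial \<open>m\<close> contributes at least \<open>c m - d \<bar>m\<bar>\<close>; and \<open>\<bar>m\<bar>\<close> is the same monomial in
  the absolute values of the coordinates.
\<close>

lemma tensor_form_ge_midpoint_radius:
  fixes L U A :: "'n::finite tensor4" and x :: "real ^ 'n"
  assumes "A \<in> {L..U}"
  shows "tensor_form (\<lambda>i j k l. (L i j k l + U i j k l) / 2) x
         - tensor_form (\<lambda>i j k l. (U i j k l - L i j k l) / 2) (\<chi> i. \<bar>x $ i\<bar>)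
         \<le> tensor_form A x"
proof -
  have bound: "(l + u) / 2 * m - (u - l) / 2 * \<bar>m\<bar> \<le> a * m" if "l \<le> a" "a \<le> u" for l u a m :: real
  proof (cases "m \<ge> 0")
    case True
    then show ?thesis using mult_right_mono[OF that(1) True] by (simp add: field_simps)
  next
    case False
    then show ?thesis using mult_right_mono_neg[OF that(2), of m] by (simp add: field_simps)
  qed
  have entry: "L i j k l \<le> A i j k l" "A i j k l \<le> U i j k l" for i j k l
    using assms by (auto simp: le_fun_def)
  show ?thesis
    unfolding tensor_form_def sum_subtractf[symmetric]
    by (intro sum_mono)
       (use bound[OF entry] in \<open>simp only: mult.assoc abs_mult[symmetric] vec_lambda_beta\<close>)
qed

theorem theorem5p1:
  fixes L U :: "3 tensor4"
  assumes "symmetric_tensor L" and "symmetric_tensor U" and "L \<le> U"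
    and "L 1 1 1 1 = 0" and "L 2 2 2 2 = 0" and "L 3 3 3 3 = 0"
    and "\<And>i j. i \<noteq> j \<Longrightarrow> L i i i j = 0 \<and> U i i i j = 0"
    and "L 1 1 2 3 = -1" and "U 1 1 2 3 = 1"
    and "L 1 2 2 3 = 0" and "L 1 2 3 3 = 0" and "U 1 2 2 3 = 0" and "U 1 2 3 3 = 0"
    and "L 1 1 2 2 \<ge> 1" and "L 1 1 3 3 \<ge> 1" and "L 2 2 3 3 \<ge> 0"
  shows "psd_interval_tensor {L..U}"
  unfolding psd_interval_tensor_def psd_tensor_def
proof (intro ballI allI impI)
  fix A :: "3 tensor4" and x :: "real ^ 3"
  assume A: "A \<in> {L..U}"
  define C where "C = (\<lambda>i j k l. (L i j k l + U i j k l) / 2)"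
  define D where "D = (\<lambda>i j k l. (U i j k l - L i j k l) / 2)"
  have sym: "symmetric_tensor C" "symmetric_tensor D"
    using assms(1,2) by (simp_all add: symmetric_tensor_def C_def D_def)
  have distinct: "(1::3) \<noteq> 2" "(1::3) \<noteq> 3" "(2::3) \<noteq> 1" "(2::3) \<noteq> 3" "(3::3) \<noteq> 1" "(3::3) \<noteq> 2"
    by simp_all
  note cubic = distinct[THEN assms(7)]
  have "0 \<le> 6 * ((x $ 1)\<^sup>2 * (\<bar>x $ 2\<bar> - \<bar>x $ 3\<bar>)\<^sup>2)"
    by simp
  also have "\<dots> = 6 * (1 * (x $ 1 * x $ 2)\<^sup>2 + 1 * (x $ 1 * x $ 3)\<^sup>2 + 0 * (x $ 2 * x $ 3)\<^sup>2)
                - 12 * ((x $ 1)\<^sup>2 * \<bar>x $ 2 * x $ 3\<bar>)"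
    by (simp add: power2_diff power_mult_distrib abs_mult algebra_simps)
  also have "\<dots> \<le> 6 * (L 1 1 2 2 * (x $ 1 * x $ 2)\<^sup>2 + L 1 1 3 3 * (x $ 1 * x $ 3)\<^sup>2
                     + L 2 2 3 3 * (x $ 2 * x $ 3)\<^sup>2) - 12 * ((x $ 1)\<^sup>2 * \<bar>x $ 2 * x $ 3\<bar>)"
    using assms(14-16) by (intro diff_right_mono mult_left_mono add_mono mult_right_mono) simp_all
  \<comment> \<open>On a square monomial \<open>C - D = L\<close>, and \<open>C = 0\<close>, \<open>D = 1\<close> at \<open>1123\<close>.\<close>
  also have "\<dots> = tensor_form C x - tensor_form D (\<chi> i. \<bar>x $ i\<bar>)"
    unfolding tensor_form_symmetric_3[OF sym(1)] tensor_form_symmetric_3[OF sym(2)]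
    using cubic assms(4-6,8-13)
    by (simp add: C_def D_def power_mult_distrib abs_mult field_simps)
  also have "\<dots> \<le> tensor_form A x"
    unfolding C_def D_def by (rule tensor_form_ge_midpoint_radius[OF A])
  finally show "0 \<le> tensor_form A x" .
qed

end
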